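(* Consider a completely randomized design with equal group sizes on $N$ units ($N\ge4$ even; $\bm{W}$ uniform on the vectors in $\{0,1\}^N$ with exactly $N/2$ ones). Let the missing potential outcomes be imputed as if the unit-level treatment effect of every unit were $\hat\tau$: $$\hat Y_i(1)=W_iY_i^{\text{obs}}+(1-W_i)(Y_i^{\text{obs}}+\hat\tau),\qquad \hat Y_i(0)=W_i(Y_i^{\text{obs}}-\hat\tau)+(1-W_i)Y_i^{\text{obs}},$$ and let $\hat c_i=\{\hat Y_i(0)+\hat Y_i(1)\}/2$, $\hat{\bm{c}}=(\hat c_1,\dots,\hat c_N)^\top$. Then the imputation-based variance estimator satisfies $$\psi(\hat{\bm{c}})=\frac{N-2}{N-1}\,\hat V_{\text{Neyman}} .$$
   Context: There are $N$ units with fixed real potential outcomes $Y_i(0),Y_i(1)$; $\bm{W}$ is the random assignment, $p_{\bm{w}}=\Pr(\bm{W}=\bm{w})$, $Y_i^{\text{obs}}=W_iY_i(1)+(1-W_i)Y_i(0)$. With $N_t=N_c=N/2$ and $\bar Y_t,\bar Y_c$ the means of the observed outcomes over treated and control units, $\hat\tau=\bar Y_t-\bar Y_c$ (equal here to the Horvitz–Thompson estimator) and $$\hat V_{\text{Neyman}}=\frac{1}{N_t(N_t-1)}\sum_{i:W_i=1}(Y_i^{\text{obs}}-\bar Y_t)^2+\frac{1}{N_c(N_c-1)}\sum_{i:W_i=0}(Y_i^{\text{obs}}-\bar Y_c)^2 .$$ For $\bm{x}\in\mathbb{R}^N$, $\psi(\bm{x})=\sum_{\bm{w}}p_{\bm{w}}\Big\{\frac{\sum_{i:w_i=1}x_i}{N/2}-\frac{\sum_{i:w_i=0}x_i}{N/2}\Big\}^2$.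 *)

theory Defs
  imports "HOL-Probability.Probability"
begin

text \<open>Units are the elements of a finite type \<open>'n\<close>, so \<open>N\<close> is \<open>CARD('n)\<close>. Assignment vectors are
  real vectors with entries 0 and 1, so that \<open>W\<^sub>i\<close> can be used directly in arithmetic.\<close>

definition assignments :: "(real ^ 'n) set" where
  "assignments = {w. \<forall>i. w $ i \<in> {0, 1}}"

definition balanced_assignments :: "(real ^ 'n) set" where
  "balanced_assignments = {w \<in> assignments. real (card {i. w $ i = 1}) = real CARD('n) / 2}"

text \<open>\<open>pmf_of_set\<close> is meaningful only on finite nonempty sets; see
  \<open>finite_balanced_assignments\<close> and \<open>balanced_assignments_nonempty\<close> below.\<close>

definition completely_randomized :: "(real ^ 'n) pmf" where
  "completely_randomized = pmf_of_set balanced_assignments"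

definition Y_obs :: "real ^ 'n \<Rightarrow> real ^ 'n \<Rightarrow> real ^ 'n \<Rightarrow> real ^ 'n" where
  "Y_obs Y0 Y1 w = (\<chi> i. w $ i * Y1 $ i + (1 - w $ i) * Y0 $ i)"

text \<open>The remaining functions take the assignment \<open>w\<close> and the observed outcomes \<open>y\<close>.\<close>

definition N_t :: "real ^ 'n \<Rightarrow> real" where
  "N_t w = real (card {i. w $ i = 1})"

definition N_c :: "real ^ 'n \<Rightarrow> real" where
  "N_c w = real (card {i. w $ i = 0})"

definition mean_t :: "real ^ 'n \<Rightarrow> real ^ 'n \<Rightarrow> real" where
  "mean_t w y = (\<Sum>i | w $ i = 1. y $ i) / N_t w"

definition mean_c :: "real ^ 'n \<Rightarrow> real ^ 'n \<Rightarrow> real" where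
  "mean_c w y = (\<Sum>i | w $ i = 0. y $ i) / N_c w"

definition tau_hat :: "real ^ 'n \<Rightarrow> real ^ 'n \<Rightarrow> real" where
  "tau_hat w y = mean_t w y - mean_c w y"

definition V_Neyman :: "real ^ 'n \<Rightarrow> real ^ 'n \<Rightarrow> real" where
  "V_Neyman w y =
     1 / (N_t w * (N_t w - 1)) * (\<Sum>i | w $ i = 1. (y $ i - mean_t w y)\<^sup>2) +
     1 / (N_c w * (N_c w - 1)) * (\<Sum>i | w $ i = 0. (y $ i - mean_c w y)\<^sup>2)"

definition Y1_imputed :: "real ^ 'n \<Rightarrow> real ^ 'n \<Rightarrow> real ^ 'n" where
  "Y1_imputed w y = (\<chi> i. w $ i * y $ i + (1 - w $ i) * (y $ i + tau_hat w y))"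

definition Y0_imputed :: "real ^ 'n \<Rightarrow> real ^ 'n \<Rightarrow> real ^ 'n" where
  "Y0_imputed w y = (\<chi> i. w $ i * (y $ i - tau_hat w y) + (1 - w $ i) * y $ i)"

definition c_hat :: "real ^ 'n \<Rightarrow> real ^ 'n \<Rightarrow> real ^ 'n" where
  "c_hat w y = (\<chi> i. (Y0_imputed w y $ i + Y1_imputed w y $ i) / 2)"

definition psi :: "(real ^ 'n) pmf \<Rightarrow> real ^ 'n \<Rightarrow> real" where
  "psi p x = (\<Sum>w\<in>assignments. pmf p w *
     ((\<Sum>i | w $ i = 1. x $ i) / (real CARD('n) / 2) -
      (\<Sum>i | w $ i = 0. x $ i) / (real CARD('n) / 2))\<^sup>2)"

lemma finite_assignments: "finite (assignments :: (real ^ 'n) set)"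
proof (rule finite_subset)
  show "(assignments :: (real ^ 'n) set) \<subseteq> (\<lambda>S. \<chi> i. of_bool (i \<in> S)) ` (UNIV :: 'n set set)"
  proof
    fix w :: "real ^ 'n" assume "w \<in> assignments"
    then have "w = (\<chi> i. of_bool (i \<in> {i. w $ i = 1}))"
      by (auto simp: assignments_def vec_eq_iff)
    then show "w \<in> (\<lambda>S. \<chi> i. of_bool (i \<in> S)) ` (UNIV :: 'n set set)" by blast
  qed
qed simp

lemma finite_balanced_assignments: "finite (balanced_assignments :: (real ^ 'n) set)"
  by (rule finite_subset[OF _ finite_assignments]) (auto simp: balanced_assignments_def)

lemma balanced_assignments_nonempty:
  assumes "even CARD('n)"
  shows "(balanced_assignments :: (real ^ 'n) set) \<noteq> {}"
proof -
  obtain S :: "'n set" where S: "card S = CARD('n) div 2"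
    using obtain_subset_with_card_n[of "CARD('n) div 2" "UNIV :: 'n set"] by auto
  have "{i. (\<chi> i. of_bool (i \<in> S) :: real ^ 'n) $ i = 1} = S" by auto
  then have "(\<chi> i. of_bool (i \<in> S)) \<in> (balanced_assignments :: (real ^ 'n) set)"
    using S assms by (auto simp: balanced_assignments_def assignments_def real_of_nat_div)
  then show ?thesis by blast
qed

end

theory Submission
  imports Defs
begin

text \<open>Put \<open>s\<^sub>i = 2 W\<^sub>i - 1\<close>. The signs satisfy \<open>s\<^sub>i\<^sup>2 = 1\<close> and sum to zero, and the covariance
  \<open>E (s\<^sub>i s\<^sub>j)\<close> is the same for all \<open>j \<noteq> i\<close> because the design is invariant under transpositions; hence
  it equals \<open>-1/(N-1)\<close>. This turns \<open>\<psi>(x)\<close> into \<open>4/(N(N-1))\<close> times the centred sum of squares of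
  \<open>x\<close>. The imputation shifts the treated outcomes by \<open>-\<tau>/2\<close> and the control outcomes by \<open>\<tau>/2\<close>
  (with \<open>\<tau>\<close> the estimate), so both groups get the common mean \<open>(Y\<^sub>t + Y\<^sub>c)/2\<close> and the centred sum
  of squares splits into the two within-group sums of the Neyman estimator.\<close>

lemma assignments_cases:
  assumes "w \<in> assignments"
  shows "w $ i = 0 \<or> w $ i = 1"
  using assms by (auto simp: assignments_def)

lemma assignments_sum_split:
  fixes w :: "real ^ 'n" and f :: "'n \<Rightarrow> real"
  assumes "w \<in> assignments"
  shows "(\<Sum>i\<in>UNIV. f i) = (\<Sum>i | w $ i = 1. f i) + (\<Sum>i | w $ i = 0. f i)"
proof -
  have "(UNIV :: 'n set) = {i. w $ i = 1} \<union> {i. w $ i = 0}"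
    using assignments_cases[OF assms] by auto
  then show ?thesis
    by (metis (mono_tags, lifting) disjoint_iff finite mem_Collect_eq sum.union_disjoint zero_neq_one)
qed

lemma treated_minus_control_eq_signed_sum:
  fixes w :: "real ^ 'n" and f :: "'n \<Rightarrow> real"
  assumes "w \<in> assignments"
  shows "(\<Sum>i | w $ i = 1. f i) - (\<Sum>i | w $ i = 0. f i) = (\<Sum>i\<in>UNIV. f i * (2 * w $ i - 1))"
proof -
  have "(\<Sum>i | w $ i = 1. f i * (2 * w $ i - 1)) = (\<Sum>i | w $ i = 1. f i)"
    by (rule sum.cong) auto
  moreover have "(\<Sum>i | w $ i = 0. f i * (2 * w $ i - 1)) = - (\<Sum>i | w $ i = 0. f i)"
    by (simp add: sum_negf)
  ultimately show ?thesis
    using assignments_sum_split[OF assms, of "\<lambda>i. f i * (2 * w $ i - 1)"] by simp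
qed

lemma balanced_card:
  fixes w :: "real ^ 'n"
  assumes "w \<in> balanced_assignments"
  shows "real (card {i. w $ i = 1}) = real CARD('n) / 2"
    and "real (card {i. w $ i = 0}) = real CARD('n) / 2"
proof -
  show 1: "real (card {i. w $ i = 1}) = real CARD('n) / 2"
    using assms by (simp add: balanced_assignments_def)
  have "w \<in> assignments" using assms by (simp add: balanced_assignments_def)
  from assignments_sum_split[OF this, of "\<lambda>_. 1"] 1
  show "real (card {i. w $ i = 0}) = real CARD('n) / 2" by simp
qed

text \<open>The signed sum of the constant 1 counts the treated units minus the control units, and a
  balanced assignment has equally many of both.\<close>

lemma balanced_sum_signs:
  fixes w :: "real ^ 'n"
  assumes "w \<in> balanced_assignments"
  shows "(\<Sum>i\<in>UNIV. 2 * w $ i - 1) = 0"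
proof -
  have "w \<in> assignments" using assms by (simp add: balanced_assignments_def)
  from treated_minus_control_eq_signed_sum[OF this, of "\<lambda>_. 1"] balanced_card[OF assms]
  show ?thesis by (simp only: sum_constant mult_1 mult_1_right diff_self)
qed

lemma balanced_permute:
  fixes w :: "real ^ 'n" and p :: "'n \<Rightarrow> 'n"
  assumes "w \<in> balanced_assignments" and "bij p"
  shows "(\<chi> i. w $ p i) \<in> balanced_assignments"
proof -
  have "{i. w $ p i = 1} = p -` {i. w $ i = 1}" by auto
  then have "card {i. w $ p i = 1} = card {i. w $ i = 1}"
    using card_vimage_inj[of p "{i. w $ i = 1}"] assms(2) by (simp only: bij_def) blast
  then show ?thesis
    using assms(1) by (simp add: balanced_assignments_def assignments_def)
qed

text \<open>Exchangeability of the design. A transposition is its own inverse, so the same map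
  serves as both witnesses of the reindexing.\<close>

lemma sum_balanced_transpose:
  fixes f :: "real ^ 'n \<Rightarrow> real" and j k :: "'n::finite"
  shows "(\<Sum>w\<in>balanced_assignments. f (\<chi> i. w $ Transposition.transpose j k i)) =
    (\<Sum>w\<in>balanced_assignments. f w)"
  by (rule sum.reindex_bij_witness[where i = "\<lambda>w. \<chi> i. w $ Transposition.transpose j k i"
        and j = "\<lambda>w. \<chi> i. w $ Transposition.transpose j k i"])
     (simp_all add: balanced_permute vec_eq_iff)

text \<open>Dividing by the number of balanced assignments gives the covariance matrix of the signs.
  The \<open>of_bool\<close> term merges its two values, 1 on the diagonal and
  \<open>-1/(N-1)\<close> off it, so that they can be substituted together under a double
  sum.\<close>

lemma sum_balanced_sign_products:
  fixes i j :: "'n::finite"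
  assumes "CARD('n) \<ge> 2"
  shows "(\<Sum>w\<in>balanced_assignments. (2 * w $ i - 1) * (2 * w $ j - 1)) =
    real (card (balanced_assignments :: (real ^ 'n) set)) * (real CARD('n) * of_bool (i = j) - 1) /
      (real CARD('n) - 1)"
proof -
  define B where "B = (balanced_assignments :: (real ^ 'n) set)"
  define K where "K = (\<lambda>j. \<Sum>w\<in>B. (2 * w $ i - 1) * (2 * w $ j - 1))"
  have diag: "K i = real (card B)"
  proof -
    have "K i = (\<Sum>w\<in>B. 1)"
      unfolding K_def
    proof (rule sum.cong)
      fix w assume "w \<in> B"
      then have "w $ i = 0 \<or> w $ i = 1"
        by (intro assignments_cases) (simp add: B_def balanced_assignments_def)
      then show "(2 * w $ i - 1) * (2 * w $ i - 1) = 1" by auto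
    qed simp
    then show ?thesis by simp
  qed
  \<comment> \<open>Swapping \<open>j\<close> and \<open>k\<close> fixes \<open>i\<close>, which
    differs from both, so only the second sign of the product changes.\<close>
  have off_diag: "K k = K j" if "k \<noteq> i" "j \<noteq> i" for j k
    using sum_balanced_transpose[of "\<lambda>w. (2 * w $ i - 1) * (2 * w $ j - 1)" j k] that
    by (simp add: K_def B_def)
  have "(\<Sum>k\<in>UNIV. K k) = (\<Sum>w\<in>B. (2 * w $ i - 1) * (\<Sum>k\<in>UNIV. 2 * w $ k - 1))"
    unfolding K_def by (subst sum.swap) (simp only: sum_distrib_left)
  also have "\<dots> = 0"
    by (intro sum.neutral) (simp add: B_def balanced_sum_signs del: sum_subtractf)
  finally have total: "(\<Sum>k\<in>UNIV. K k) = 0" .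
  have "K j = - real (card B) / (real CARD('n) - 1)" if "j \<noteq> i"
  proof -
    \<comment> \<open>The row of \<open>i\<close> sums to zero and consists of the known diagonal
      entry and \<open>N - 1\<close> equal entries, which determines their value.\<close>
    have "(\<Sum>k\<in>UNIV. K k) = K i + (\<Sum>k\<in>UNIV - {i}. K k)"
      by (rule sum.remove) simp_all
    also have "(\<Sum>k\<in>UNIV - {i}. K k) = (\<Sum>k\<in>UNIV - {i}. K j)"
      by (intro sum.cong refl off_diag that) simp
    finally have "(real CARD('n) - 1) * K j = - real (card B)"
      using total diag assms by (simp add: card_Diff_singleton of_nat_diff)
    then have "K j * (real CARD('n) - 1) = - real (card B)" by (simp only: mult.commute)
    moreover have "real CARD('n) - 1 \<noteq> 0" using assms by simp
    ultimately show ?thesis using nonzero_eq_divide_eq by blast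
  qed
  then have "K j = real (card B) * (real CARD('n) * of_bool (i = j) - 1) / (real CARD('n) - 1)"
    using diag assms by (cases "i = j") auto
  then show ?thesis by (simp add: K_def B_def)
qed

text \<open>Expanding the square reduces \<open>psi\<close> to a quadratic form in the sign
  covariances. The number \<open>m\<close> is the mean of \<open>x\<close>.\<close>

lemma psi_completely_randomized:
  fixes x :: "real ^ 'n"
  assumes "CARD('n) \<ge> 2" and "even CARD('n)" and mean: "(\<Sum>i\<in>UNIV. x $ i) = real CARD('n) * m"
  shows "psi completely_randomized x =
    4 / (real CARD('n) * (real CARD('n) - 1)) * (\<Sum>i\<in>UNIV. (x $ i - m)\<^sup>2)"
proof -
  define B where "B = (balanced_assignments :: (real ^ 'n) set)"
  define N where "N = real CARD('n)"
  define b where "b = real (card B)"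
  have B: "finite B" "B \<noteq> {}"
    unfolding B_def using finite_balanced_assignments balanced_assignments_nonempty assms(2) by auto
  then have b: "b > 0" by (simp add: b_def card_gt_0_iff)
  have N: "N \<ge> 2" using assms(1) by (simp add: N_def)
  have sub: "B \<subseteq> assignments" by (auto simp: B_def balanced_assignments_def)
  have centred: "(\<Sum>i\<in>UNIV. (x $ i - m)\<^sup>2) = (\<Sum>i\<in>UNIV. (x $ i)\<^sup>2) - N * m\<^sup>2"
  proof -
    have "(\<Sum>i\<in>UNIV. (x $ i - m)\<^sup>2) =
        (\<Sum>i\<in>UNIV. (x $ i)\<^sup>2) + N * m\<^sup>2 - 2 * m * (\<Sum>i\<in>UNIV. x $ i)"
      by (simp add: power2_diff sum.distrib sum_subtractf sum_distrib_left N_def mult_ac)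
    then show ?thesis using mean by (simp add: N_def power2_eq_square algebra_simps)
  qed
  \<comment> \<open>Unbalanced assignments have probability zero, so the sum may be restricted to
    \<open>B\<close>.\<close>
  have "psi completely_randomized x = (\<Sum>w\<in>B. pmf completely_randomized w *
     ((\<Sum>i | w $ i = 1. x $ i) / (N / 2) - (\<Sum>i | w $ i = 0. x $ i) / (N / 2))\<^sup>2)"
    unfolding psi_def N_def
    by (rule sum.mono_neutral_right[OF finite_assignments sub])
       (use B in \<open>simp add: completely_randomized_def B_def\<close>)
  \<comment> \<open>The factor combines the uniform probability \<open>1 / b\<close> with the square
    of the divisor \<open>N / 2\<close>.\<close>
  also have "\<dots> = (\<Sum>w\<in>B. 4 / (b * N\<^sup>2) * (\<Sum>i\<in>UNIV. x $ i * (2 * w $ i - 1))\<^sup>2)"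
  proof (rule sum.cong)
    fix w assume w: "w \<in> B"
    have "pmf completely_randomized w = 1 / b"
      using B w by (simp add: completely_randomized_def B_def b_def)
    moreover have "(\<Sum>i | w $ i = 1. x $ i) / (N / 2) - (\<Sum>i | w $ i = 0. x $ i) / (N / 2) =
        (\<Sum>i\<in>UNIV. x $ i * (2 * w $ i - 1)) / (N / 2)"
      using treated_minus_control_eq_signed_sum[of w "\<lambda>i. x $ i"] w sub
      by (auto simp flip: diff_divide_distrib)
    ultimately show "pmf completely_randomized w *
        ((\<Sum>i | w $ i = 1. x $ i) / (N / 2) - (\<Sum>i | w $ i = 0. x $ i) / (N / 2))\<^sup>2 =
        4 / (b * N\<^sup>2) * (\<Sum>i\<in>UNIV. x $ i * (2 * w $ i - 1))\<^sup>2"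
      by (simp add: power_divide)
  qed simp
  also have "\<dots> = 4 / (b * N\<^sup>2) *
      (\<Sum>w\<in>B. \<Sum>i\<in>UNIV. \<Sum>j\<in>UNIV. x $ i * x $ j * ((2 * w $ i - 1) * (2 * w $ j - 1)))"
  proof -
    have "(\<Sum>i\<in>UNIV. x $ i * (2 * w $ i - 1))\<^sup>2 =
        (\<Sum>i\<in>UNIV. \<Sum>j\<in>UNIV. x $ i * x $ j * ((2 * w $ i - 1) * (2 * w $ j - 1)))" for w :: "real ^ 'n"
      unfolding power2_eq_square sum_product by (simp only: mult_ac)
    then show ?thesis by (simp only: sum_distrib_left)
  qed
  also have "(\<Sum>w\<in>B. \<Sum>i\<in>UNIV. \<Sum>j\<in>UNIV. x $ i * x $ j * ((2 * w $ i - 1) * (2 * w $ j - 1))) =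
      (\<Sum>i\<in>UNIV. \<Sum>j\<in>UNIV. x $ i * x $ j * (\<Sum>w\<in>B. (2 * w $ i - 1) * (2 * w $ j - 1)))"
    unfolding sum_distrib_left
    by (rule trans[OF sum.swap]) (rule sum.cong[OF refl], rule sum.swap)
  \<comment> \<open>With the diagonal part written as a conditional, its sum over \<open>j\<close>
    collapses to a single term; the other part becomes the square of the sum of
    \<open>x\<close>.\<close>
  also have "\<dots> = (\<Sum>i\<in>UNIV. \<Sum>j\<in>UNIV. b / (N - 1) *
      ((if i = j then N * (x $ i * x $ j) else 0) - x $ i * x $ j))"
    unfolding B_def sum_balanced_sign_products[OF assms(1)]
    by (intro sum.cong refl) (simp add: b_def B_def N_def field_simps)
  also have "\<dots> = b / (N - 1) * (N * (\<Sum>i\<in>UNIV. (x $ i)\<^sup>2) - (\<Sum>i\<in>UNIV. x $ i)\<^sup>2)"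
    unfolding sum_distrib_left[symmetric] power2_eq_square sum_product
    by (simp add: sum_subtractf sum_distrib_left)
  also have "(\<Sum>i\<in>UNIV. x $ i)\<^sup>2 = N * (N * m\<^sup>2)"
    using mean by (simp add: N_def power2_eq_square)
  also have "4 / (b * N\<^sup>2) * (b / (N - 1) * (N * (\<Sum>i\<in>UNIV. (x $ i)\<^sup>2) - N * (N * m\<^sup>2))) =
      4 / (N * (N - 1)) * (\<Sum>i\<in>UNIV. (x $ i - m)\<^sup>2)"
    unfolding centred right_diff_distrib[symmetric] using b N
    by (simp add: power2_eq_square)
  finally show ?thesis by (simp add: N_def)
qed

lemma c_hat_nth:
  "c_hat w y $ i = y $ i + (1 - 2 * w $ i) * tau_hat w y / 2"
  by (simp add: c_hat_def Y0_imputed_def Y1_imputed_def field_simps)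

theorem proposition5p4:
  fixes Y0 Y1 W :: "real ^ 'n"
  assumes "CARD('n) \<ge> 4" and "even CARD('n)"
    and "W \<in> set_pmf completely_randomized"
  shows "psi completely_randomized (c_hat W (Y_obs Y0 Y1 W)) =
    (real CARD('n) - 2) / (real CARD('n) - 1) * V_Neyman W (Y_obs Y0 Y1 W)"
proof -
  define y where "y = Y_obs Y0 Y1 W"
  define N where "N = real CARD('n)"
  define m where "m = (mean_t W y + mean_c W y) / 2"
  define St where "St = (\<Sum>i | W $ i = 1. (y $ i - mean_t W y)\<^sup>2)"
  define Sc where "Sc = (\<Sum>i | W $ i = 0. (y $ i - mean_c W y)\<^sup>2)"
  have N: "N \<ge> 4" using assms(1) by (simp add: N_def)
  have W: "W \<in> balanced_assignments"
    using assms(3) by (simp add: completely_randomized_def finite_balanced_assignments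
        balanced_assignments_nonempty[OF assms(2)])
  then have W': "W \<in> assignments" by (simp add: balanced_assignments_def)
  have sizes: "N_t W = N / 2" "N_c W = N / 2"
    using balanced_card[OF W] by (simp_all add: N_t_def N_c_def N_def)
  \<comment> \<open>\<open>mean_t W y - m\<close> is half of \<open>tau_hat W y\<close>, exactly the
    amount that the imputation subtracts from a treated outcome. For a control unit both signs are
    reversed.\<close>
  have treated: "c_hat W y $ i - m = y $ i - mean_t W y" if "W $ i = 1" for i
    using that by (simp add: c_hat_nth m_def tau_hat_def field_simps)
  have control: "c_hat W y $ i - m = y $ i - mean_c W y" if "W $ i = 0" for i
    using that by (simp add: c_hat_nth m_def tau_hat_def field_simps)
  have "(\<Sum>i\<in>UNIV. c_hat W y $ i - m) =
      (\<Sum>i | W $ i = 1. y $ i - mean_t W y) + (\<Sum>i | W $ i = 0. y $ i - mean_c W y)"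
    unfolding assignments_sum_split[OF W'] by (simp add: treated control)
  \<comment> \<open>Both group sizes are nonzero, so each group mean times its size is the group
    total and the deviations cancel.\<close>
  also have "\<dots> = 0"
    using sizes N by (simp add: sum_subtractf mean_t_def mean_c_def flip: N_t_def N_c_def)
  finally have "(\<Sum>i\<in>UNIV. c_hat W y $ i) = real CARD('n) * m"
    by (simp add: sum_subtractf)
  then have "psi completely_randomized (c_hat W y) =
      4 / (N * (N - 1)) * (\<Sum>i\<in>UNIV. (c_hat W y $ i - m)\<^sup>2)"
    unfolding N_def using assms by (intro psi_completely_randomized) auto
  also have "(\<Sum>i\<in>UNIV. (c_hat W y $ i - m)\<^sup>2) = St + Sc"
    unfolding assignments_sum_split[OF W'] St_def Sc_def by (simp add: treated control)
  also have "4 / (N * (N - 1)) * (St + Sc) =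
      (N - 2) / (N - 1) * (1 / (N / 2 * (N / 2 - 1)) * (St + Sc))"
  proof -
    have "1 / (N / 2 * (N / 2 - 1)) = 4 / (N * (N - 2))"
      using N by (simp add: field_simps)
    then show ?thesis using N by simp
  qed
  also have "1 / (N / 2 * (N / 2 - 1)) * (St + Sc) = V_Neyman W y"
    by (simp only: V_Neyman_def sizes St_def Sc_def distrib_left)
  finally show ?thesis by (simp add: y_def N_def)
qed

end
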